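(* Consider full-batch Noisy-SGD ($\mathcal{B}_t=[n]$, $b=n$) run for $T\ge1$ iterations, and assume that for every $d\in\mathcal{X}$ the gradient $\nabla\ell(\cdot;d)$ is $(L,\lambda)$-Hölder continuous on $\mathcal{K}$ with $L\ge0$, $\lambda\in(0,1]$. Let $g(x)=x+\eta Lx^\lambda$ on $\mathbb{R}_{\ge0}$ and $h=g^{-1}:\mathbb{R}_{\ge0}\to\mathbb{R}_{\ge0}$. Then for every $\alpha>1$, $W_T$ is $(\alpha,\varepsilon(\alpha))$-RDP with $$\varepsilon(\alpha)\le\min_{\tau,\beta,a}\ \frac{\alpha}{2\sigma^2}\sum_{t=\tau}^{T-1}\left(\frac{1}{\beta_t}\Big(\frac{2\eta K}{n}\Big)^2+\frac{a_t^2}{1-\beta_t}\right),$$ where the minimum is over $\tau\in\{0,\dots,T-1\}$, $\beta_t\in[0,1]$ and $a_t\ge0$ for $t\ge\tau$, subject to $A_\tau\ge D_\tau$, where $A_T=0$, $A_{t-1}=h(A_t+a_{t-1})$ for $t=T,T-1,\dots,\tau+1$, and $D_0=0$, $D_t=\min\big(g(D_{t-1})+2\eta K/n,\ D_{t-1}+2\eta K,\ D\big)$ for $t\ge1$.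
   Context: Setting (Noisy-SGD). Let $\mathcal{K}\subset\mathbb{R}^d$ be a nonempty closed convex set of diameter $D$, and $\Pi_{\mathcal{K}}$ the Euclidean projection onto $\mathcal{K}$. Let $\mathcal{X}$ be a data domain and $\ell(\cdot;d)$, $d\in\mathcal{X}$, differentiable loss functions on $\mathcal{K}$. For a dataset $\mathcal{D}=(d_1,\dots,d_n)\in\mathcal{X}^n$ write $\ell_i=\ell(\cdot;d_i)$. For $K>0$, $\Pi_{B_K}(v)=v\min(1,K/\|v\|)$ is the projection onto the closed Euclidean ball of radius $K$. Given step size $\eta>0$, noise level $\sigma>0$, batch size $b$, index sets $\mathcal{B}_t\subseteq[n]$ with $|\mathcal{B}_t|=b$, and $W_0\in\mathcal{K}$, Noisy-SGD iterates $W_{t+1}=\Pi_{\mathcal{K}}\big[W_t-\eta\frac1b\sum_{i\in\mathcal{B}_t}\Pi_{B_K}[\nabla\ell_i(W_t)]+G_t\big]$, with $G_t$ i.i.d. $N(0,\sigma^2I_d)$ independent of everything else. Datasets $\mathcal{D},\mathcal{D}'\in\mathcal{X}^n$ are adjacent if they differ in exactly one index $i^\star$; $W_t,W_t'$ denote iterates on $\mathcal{D},\mathcal{D}'$ with the same $W_0$ and batch sequence. The algorithm outputting $W_T$ is $(\alpha,\varepsilon)$-RDP if $D_\alpha(W_T\|W_T')\le\varepsilon$ for all adjacent pairs, where $D_\alpha(\mu\|\nu)=\frac{1}{\alpha-1}\log\int(\mu/\nu)^\alpha d\nu$ if $\mu\ll\nu$, $+\infty$ otherwise. A map $f:\mathcal{K}\to\mathbb{R}^d$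 is $(L,\lambda)$-Hölder continuous if $\|f(w)-f(w')\|\le L\|w-w'\|^\lambda$ for all $w,w'\in\mathcal{K}$. Conventions: $x/0=+\infty$ for $x>0$, $0/0=0$. *)

theory Defs
  imports "HOL-Probability.Probability"
begin

definition clipK :: "real \<Rightarrow> 'a::euclidean_space \<Rightarrow> 'a" where
  "clipK K v = (if norm v \<le> K then v else (K / norm v) *\<^sub>R v)"

definition gauss_noise :: "real \<Rightarrow> 'a::euclidean_space measure" where
  "gauss_noise \<sigma> = density lborel
     (\<lambda>x. ennreal ((2 * pi * \<sigma>\<^sup>2) powr (- real DIM('a) / 2) * exp (- (norm x)\<^sup>2 / (2 * \<sigma>\<^sup>2))))"

text \<open>One full-batch Noisy-SGD step (Markov kernel). Iterates never leave Ks,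
  the else-branch only makes the kernel total.\<close>
definition sgd_step ::
  "'a::euclidean_space set \<Rightarrow> ('x \<Rightarrow> 'a \<Rightarrow> 'a) \<Rightarrow> real \<Rightarrow> real \<Rightarrow> real \<Rightarrow> nat \<Rightarrow> (nat \<Rightarrow> 'x)
   \<Rightarrow> 'a \<Rightarrow> 'a measure" where
  "sgd_step Ks grad K \<eta> \<sigma> n ds w =
     (if w \<in> Ks then
        distr (gauss_noise \<sigma>) borel
          (\<lambda>G. closest_point Ks
                 (w - \<eta> *\<^sub>R ((1 / real n) *\<^sub>R (\<Sum>i<n. clipK K (grad (ds i) w))) + G))
      else return borel w)"

fun noisy_sgd ::
  "'a::euclidean_space set \<Rightarrow> ('x \<Rightarrow> 'a \<Rightarrow> 'a) \<Rightarrow> real \<Rightarrow> real \<Rightarrow> real \<Rightarrow> nat \<Rightarrow> (nat \<Rightarrow> 'x)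
   \<Rightarrow> 'a \<Rightarrow> nat \<Rightarrow> 'a measure" where
  "noisy_sgd Ks grad K \<eta> \<sigma> n ds W0 0 = return borel W0"
| "noisy_sgd Ks grad K \<eta> \<sigma> n ds W0 (Suc t) =
     noisy_sgd Ks grad K \<eta> \<sigma> n ds W0 t \<bind> sgd_step Ks grad K \<eta> \<sigma> n ds"

definition renyi_div :: "real \<Rightarrow> 'a measure \<Rightarrow> 'a measure \<Rightarrow> ereal" where
  "renyi_div \<alpha> \<mu> \<nu> =
     (if sets \<mu> = sets \<nu> \<and> absolutely_continuous \<nu> \<mu> then
        (let I = (\<integral>\<^sup>+ x. ennreal (enn2real (RN_deriv \<nu> \<mu> x) powr \<alpha>) \<partial>\<nu>)
         in if I = \<infinity> then \<infinity> else ereal (ln (enn2real I) / (\<alpha> - 1)))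
      else \<infinity>)"

definition ediv :: "real \<Rightarrow> real \<Rightarrow> ereal" where
  "ediv x y = (if y = 0 then (if x > 0 then \<infinity> else 0) else ereal (x / y))"

definition gfun :: "real \<Rightarrow> real \<Rightarrow> real \<Rightarrow> real \<Rightarrow> real" where
  "gfun \<eta> L lam x = x + \<eta> * L * x powr lam"

definition hfun :: "real \<Rightarrow> real \<Rightarrow> real \<Rightarrow> real \<Rightarrow> real" where
  "hfun \<eta> L lam y = (THE x. 0 \<le> x \<and> gfun \<eta> L lam x = y)"

text \<open>Abk h a T k = A_{T-k}: A_T = 0, A_{t-1} = h(A_t + a_{t-1}).\<close>
fun Abk :: "(real \<Rightarrow> real) \<Rightarrow> (nat \<Rightarrow> real) \<Rightarrow> nat \<Rightarrow> nat \<Rightarrow> real" where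
  "Abk h a T 0 = 0"
| "Abk h a T (Suc k) = h (Abk h a T k + a (T - Suc k))"

definition Aseq :: "(real \<Rightarrow> real) \<Rightarrow> (nat \<Rightarrow> real) \<Rightarrow> nat \<Rightarrow> nat \<Rightarrow> real" where
  "Aseq h a T t = Abk h a T (T - t)"

fun Dseq :: "(real \<Rightarrow> real) \<Rightarrow> real \<Rightarrow> real \<Rightarrow> nat \<Rightarrow> real \<Rightarrow> nat \<Rightarrow> real" where
  "Dseq g \<eta> K n D 0 = 0"
| "Dseq g \<eta> K n D (Suc t) =
     min (min (g (Dseq g \<eta> K n D t) + 2 * \<eta> * K / real n) (Dseq g \<eta> K n D t + 2 * \<eta> * K)) D"

end

theory Submission
  imports Defs
begin

text \<open>
  Put \<open>p = \<alpha> / (\<alpha> - 1)\<close>. By duality, \<open>D\<^sub>\<alpha>(\<mu> \<parallel> \<nu>) \<le> \<epsilon>\<close> holds as soon as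
  \<open>(\<integral>f d\<mu>)\<^sup>p \<le> e\<^sup>\<epsilon> \<integral>f\<^sup>p d\<nu>\<close> for all bounded measurable \<open>f \<ge> 0\<close>, and by Hoelder's inequality a Gaussian
  shifted by \<open>c\<close> satisfies this with \<open>\<epsilon> = \<alpha> |c|\<^sup>2 / (2 \<sigma>\<^sup>2)\<close>.

  The dual inequality can be propagated backwards in time, pointwise in the starting points: the claim at
  time \<open>t\<close> is \<open>E[f(W\<^sub>T) | W\<^sub>t = w]\<^sup>p \<le> exp(\<epsilon>\<^sub>t) E[f(W'\<^sub>T)\<^sup>p | W'\<^sub>t = z]\<close> for all \<open>w\<close>, \<open>z\<close> at distance
  at most \<open>A\<^sub>t\<close>. One step moves the two means apart by at most \<open>g(A\<^sub>t) + 2\<eta>K/n = A\<^sub>t\<^sub>+\<^sub>1 + a\<^sub>t + 2\<eta>K/n\<close>;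
  a shift of the second noise by a vector of norm at most \<open>a\<^sub>t + 2\<eta>K/n\<close> brings the next iterates within
  \<open>A\<^sub>t\<^sub>+\<^sub>1\<close>, at cost \<open>\<alpha> (a\<^sub>t + 2\<eta>K/n)\<^sup>2 / (2 \<sigma>\<^sup>2)\<close>, and
  \<open>(s + a)\<^sup>2 \<le> s\<^sup>2 / \<beta> + a\<^sup>2 / (1 - \<beta>)\<close>. Before time \<open>\<tau>\<close> the two chains use the same noise, which costs
  nothing and keeps them within \<open>D\<^sub>t\<close>.
\<close>

section \<open>Hoelder's inequality\<close>

text \<open>Normalised by the norms \<open>u\<close> and \<open>v\<close>, the factors satisfy
  Young's inequality pointwise, and integrating it gives the claim. The same bound yields
  integrability of the product; if one norm vanishes, the product is zero almost everywhere.\<close>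

lemma integral_Holder:
  fixes f g :: "'a \<Rightarrow> real"
  assumes pq: "p > 1" "q > 1" "1 / p + 1 / q = 1"
    and f: "f \<in> borel_measurable M" "\<And>x. 0 \<le> f x" "integrable M (\<lambda>x. f x powr p)"
    and g: "g \<in> borel_measurable M" "\<And>x. 0 \<le> g x" "integrable M (\<lambda>x. g x powr q)"
  shows "(\<integral>x. f x * g x \<partial>M) \<le> (\<integral>x. f x powr p \<partial>M) powr (1 / p) * (\<integral>x. g x powr q \<partial>M) powr (1 / q)"
proof -
  let ?A = "\<integral>x. f x powr p \<partial>M" and ?B = "\<integral>x. g x powr q \<partial>M"
  have nn: "0 \<le> ?A" "0 \<le> ?B" by simp_all
  consider "?A = 0" | "?B = 0" | "?A > 0" "?B > 0" using nn by linarith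
  then show ?thesis
  proof cases
    case 1
    then have "AE x in M. f x powr p = 0"
      using f by (subst (asm) integral_nonneg_eq_0_iff_AE) auto
    then have "(\<integral>x. f x * g x \<partial>M) = (\<integral>x. 0 \<partial>M)"
      using f g by (intro integral_cong_AE) auto
    then show ?thesis by simp
  next
    case 2
    then have "AE x in M. g x powr q = 0"
      using g by (subst (asm) integral_nonneg_eq_0_iff_AE) auto
    then have "(\<integral>x. f x * g x \<partial>M) = (\<integral>x. 0 \<partial>M)"
      using f g by (intro integral_cong_AE) auto
    then show ?thesis by simp
  next
    case 3
    define u where "u = ?A powr (1 / p)"
    define v where "v = ?B powr (1 / q)"
    have uv: "u > 0" "v > 0" "u powr p = ?A" "v powr q = ?B"
      using 3 pq by (auto simp: u_def v_def powr_powr)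
    let ?h = "\<lambda>x. u * v * (f x powr p / ?A / p + g x powr q / ?B / q)"
    have pt: "f x * g x \<le> ?h x" for x
    proof -
      have "(f x / u) * (g x / v) \<le> (f x / u) powr p / p + (g x / v) powr q / q"
        using pq f g uv by (intro Youngs_inequality) (auto simp: add_divide_distrib)
      also have "\<dots> = f x powr p / ?A / p + g x powr q / ?B / q"
        using f g uv by (simp add: powr_divide)
      finally show ?thesis
        using uv by (simp add: field_simps)
    qed
    have int: "integrable M ?h" using f g by auto
    have "integrable M (\<lambda>x. f x * g x)"
    proof (rule Bochner_Integration.integrable_bound[OF int])
      have "norm (f x * g x) \<le> norm (?h x)" for x
        using pt[of x] mult_nonneg_nonneg[OF f(2)[of x] g(2)[of x]] unfolding real_norm_def by linarith
      then show "AE x in M. norm (f x * g x) \<le> norm (?h x)" by blast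
    qed (use f g in auto)
    then have "(\<integral>x. f x * g x \<partial>M) \<le> (\<integral>x. ?h x \<partial>M)"
      using int pt by (intro integral_mono) auto
    also have "\<dots> = u * v * (1 / p + 1 / q)"
      using f g 3 by simp
    finally show ?thesis
      using pq(3) by (simp add: u_def v_def)
  qed
qed

section \<open>Gaussian noise and its shifts\<close>

text \<open>Factoring over the coordinates reduces the total mass to that of one-dimensional normal
  densities.\<close>

lemma gauss_noise_density_eq_prod:
  fixes x :: "'a::euclidean_space"
  assumes "\<sigma> > 0"
  shows "(2 * pi * \<sigma>\<^sup>2) powr (- real DIM('a) / 2) * exp (- (norm x)\<^sup>2 / (2 * \<sigma>\<^sup>2)) =
    (\<Prod>b\<in>Basis. normal_density 0 \<sigma> (x \<bullet> b))"
proof -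
  have "(2 * pi * \<sigma>\<^sup>2) powr (- real DIM('a) / 2) = (1 / sqrt (2 * pi * \<sigma>\<^sup>2)) ^ DIM('a)"
  proof -
    have "1 / sqrt (2 * pi * \<sigma>\<^sup>2) = (2 * pi * \<sigma>\<^sup>2) powr (- (1 / 2))"
      unfolding powr_minus by (simp add: powr_half_sqrt inverse_eq_divide)
    moreover have "((2 * pi * \<sigma>\<^sup>2) powr (- (1 / 2))) ^ DIM('a) = (2 * pi * \<sigma>\<^sup>2) powr (- (1 / 2) * real DIM('a))"
      using assms by (subst powr_realpow[symmetric]) (simp, simp only: powr_powr)
    ultimately show ?thesis by simp
  qed
  moreover have "exp (- (norm x)\<^sup>2 / (2 * \<sigma>\<^sup>2)) = (\<Prod>b\<in>Basis. exp (- (x \<bullet> b)\<^sup>2 / (2 * \<sigma>\<^sup>2)))"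
    unfolding power2_norm_eq_inner euclidean_inner[of x x]
    by (simp add: exp_sum[symmetric] sum_divide_distrib sum_negf power2_eq_square)
  ultimately show ?thesis
    by (simp add: normal_density_def prod_dividef power_one_over)
qed

lemma prob_space_gauss_noise:
  assumes "\<sigma> > 0"
  shows "prob_space (gauss_noise \<sigma> :: 'a::euclidean_space measure)"
proof
  have 1: "(\<integral>\<^sup>+x. ennreal (normal_density 0 \<sigma> x) \<partial>lborel) = 1"
    by (simp add: nn_integral_eq_integral assms)
  have "emeasure (gauss_noise \<sigma> :: 'a measure) (space (gauss_noise \<sigma>)) =
      (\<integral>\<^sup>+x. (\<Prod>b\<in>Basis. ennreal (normal_density 0 \<sigma> (x \<bullet> b))) \<partial>(lborel :: 'a measure))"
    unfolding gauss_noise_def gauss_noise_density_eq_prod[OF assms]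
    by (simp add: emeasure_density prod_ennreal)
  also have "\<dots> = (\<Prod>b\<in>(Basis::'a set). (\<integral>\<^sup>+x. ennreal (normal_density 0 \<sigma> x) \<partial>lborel))"
    by (rule nn_integral_lborel_prod) auto
  finally show "emeasure (gauss_noise \<sigma> :: 'a measure) (space (gauss_noise \<sigma>)) = 1"
    by (simp add: 1)
qed

lemma sets_gauss_noise [simp, measurable_cong]: "sets (gauss_noise \<sigma>) = sets borel"
  by (simp add: gauss_noise_def)

lemma space_gauss_noise [simp]: "space (gauss_noise \<sigma>) = UNIV"
  by (simp add: gauss_noise_def)

text \<open>For \<sigma> > 0, the likelihood ratio of the Gaussian with mean \<open>c\<close> to the
  centred one.\<close>

definition gauss_tilt :: "real \<Rightarrow> 'a::euclidean_space \<Rightarrow> 'a \<Rightarrow> real" where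
  "gauss_tilt \<sigma> c x = exp ((2 * (x \<bullet> c) - (norm c)\<^sup>2) / (2 * \<sigma>\<^sup>2))"

lemma borel_measurable_gauss_tilt [measurable]: "gauss_tilt \<sigma> c \<in> borel_measurable borel"
  unfolding gauss_tilt_def[abs_def] by measurable

lemma gauss_tilt_nonneg [simp]: "0 \<le> gauss_tilt \<sigma> c x"
  by (simp add: gauss_tilt_def)

text \<open>Translation invariance of \<open>lborel\<close> moves the shift into the density;
  expanding the square in the exponent then splits off the tilt as a factor.\<close>

lemma distr_gauss_noise_shift:
  fixes c :: "'a::euclidean_space"
  shows "distr (gauss_noise \<sigma>) borel (\<lambda>x. x + c) = density (gauss_noise \<sigma>) (\<lambda>x. ennreal (gauss_tilt \<sigma> c x))"
proof (rule measure_eqI)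
  fix A assume "A \<in> sets (distr (gauss_noise \<sigma>) borel (\<lambda>x::'a. x + c))"
  then have A [measurable]: "A \<in> sets borel" by simp
  let ?q = "\<lambda>x::'a. (2 * pi * \<sigma>\<^sup>2) powr (- real DIM('a) / 2) * exp (- (norm x)\<^sup>2 / (2 * \<sigma>\<^sup>2))"
  have [measurable]: "(+) c \<in> borel \<rightarrow>\<^sub>M borel" by measurable
  have q: "?q (x - c) = ?q x * gauss_tilt \<sigma> c x" for x
  proof -
    have "(norm (x - c))\<^sup>2 = (norm x)\<^sup>2 - (2 * (x \<bullet> c) - (norm c)\<^sup>2)"
      by (simp add: power2_norm_eq_inner inner_diff inner_commute)
    then show ?thesis
      by (simp add: gauss_tilt_def mult_exp_exp diff_divide_distrib)
  qed
  have "emeasure (distr (gauss_noise \<sigma>) borel (\<lambda>x. x + c)) A =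
      (\<integral>\<^sup>+x. indicator A x \<partial>(distr (gauss_noise \<sigma>) borel (\<lambda>x. x + c)))"
    by simp
  also have "\<dots> = (\<integral>\<^sup>+x. ennreal (?q x) * indicator A (x + c) \<partial>lborel)"
    by (simp add: nn_integral_distr gauss_noise_def nn_integral_density del: nn_integral_indicator)
  also have "\<dots> = (\<integral>\<^sup>+x. ennreal (?q (c + x - c)) * indicator A (c + x) \<partial>lborel)"
    by (simp add: add.commute)
  also have "\<dots> = (\<integral>\<^sup>+x. ennreal (?q (x - c)) * indicator A x \<partial>(distr lborel borel ((+) c)))"
    by (subst nn_integral_distr) auto
  also have "\<dots> = (\<integral>\<^sup>+x. ennreal (?q x) * (ennreal (gauss_tilt \<sigma> c x) * indicator A x) \<partial>lborel)"
    unfolding lborel_distr_plus q by (simp add: ennreal_mult mult.assoc)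
  also have "\<dots> = emeasure (density (gauss_noise \<sigma>) (\<lambda>x. ennreal (gauss_tilt \<sigma> c x))) A"
    by (simp add: emeasure_density gauss_noise_def nn_integral_density)
  finally show "emeasure (distr (gauss_noise \<sigma>) borel (\<lambda>x. x + c)) A =
      emeasure (density (gauss_noise \<sigma>) (\<lambda>x. ennreal (gauss_tilt \<sigma> c x))) A" .
qed simp

lemma integral_gauss_noise_shift:
  fixes f :: "'a::euclidean_space \<Rightarrow> real"
  assumes [measurable]: "f \<in> borel_measurable borel"
  shows "(\<integral>x. f (x + c) \<partial>gauss_noise \<sigma>) = (\<integral>x. f x * gauss_tilt \<sigma> c x \<partial>gauss_noise \<sigma>)"
proof -
  have "(\<integral>x. f (x + c) \<partial>gauss_noise \<sigma>) = (\<integral>x. f x \<partial>(distr (gauss_noise \<sigma>) borel (\<lambda>x. x + c)))"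
    by (subst integral_distr) auto
  also have "\<dots> = (\<integral>x. f x * gauss_tilt \<sigma> c x \<partial>gauss_noise \<sigma>)"
    unfolding distr_gauss_noise_shift by (subst integral_density) (auto simp: mult.commute)
  finally show ?thesis .
qed

text \<open>The integral is the total mass of the shifted Gaussian, so no exponential moment has to
  be computed.\<close>

lemma has_bochner_integral_gauss_tilt:
  fixes c :: "'a::euclidean_space"
  assumes "\<sigma> > 0"
  shows "has_bochner_integral (gauss_noise \<sigma>) (gauss_tilt \<sigma> c) 1"
proof -
  interpret prob_space "gauss_noise \<sigma> :: 'a measure" by (rule prob_space_gauss_noise[OF assms])
  interpret T: prob_space "density (gauss_noise \<sigma>) (\<lambda>x. ennreal (gauss_tilt \<sigma> c x))"
    unfolding distr_gauss_noise_shift[symmetric] by (rule prob_space_distr) simp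
  show ?thesis
    using T.emeasure_space_1
    by (intro has_bochner_integral_nn_integral) (auto simp: emeasure_density cong: nn_integral_cong)
qed

text \<open>Completing the square leaves the coefficient \<open>\<alpha>\<^sup>2 - \<alpha>\<close>
  of the squared norm. For \<sigma> > 0 the tilt on the right has integral 1, so the leading factor
  is the \<alpha>-th moment of the tilt.\<close>

lemma gauss_tilt_powr:
  "gauss_tilt \<sigma> c x powr \<alpha> =
    exp (\<alpha> * (\<alpha> - 1) * (norm c)\<^sup>2 / (2 * \<sigma>\<^sup>2)) * gauss_tilt \<sigma> (\<alpha> *\<^sub>R c) x"
  by (simp add: gauss_tilt_def exp_powr_real mult_exp_exp add_divide_distrib[symmetric])
    (simp add: algebra_simps power2_eq_square)

text \<open>Once the shift is written as a tilt, Hoelder's inequality with the conjugate exponents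
  \<open>p\<close> and \<alpha> applies; the tilt contributes only its \<alpha>-th moment.\<close>

lemma gauss_noise_shift_powr_le:
  fixes f :: "'a::euclidean_space \<Rightarrow> real"
  assumes \<sigma>: "\<sigma> > 0" and \<alpha>: "\<alpha> > 1"
    and f [measurable]: "f \<in> borel_measurable borel" and bnd: "\<And>x. 0 \<le> f x" "\<And>x. f x \<le> B"
  shows "(\<integral>x. f (x + c) \<partial>gauss_noise \<sigma>) powr (\<alpha> / (\<alpha> - 1)) \<le>
    exp (\<alpha> * (norm c)\<^sup>2 / (2 * \<sigma>\<^sup>2)) * (\<integral>x. f x powr (\<alpha> / (\<alpha> - 1)) \<partial>gauss_noise \<sigma>)"
proof -
  interpret prob_space "gauss_noise \<sigma> :: 'a measure" by (rule prob_space_gauss_noise[OF \<sigma>])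
  define p where "p = \<alpha> / (\<alpha> - 1)"
  have p: "p > 1" "1 / p + 1 / \<alpha> = 1" using \<alpha> by (auto simp: p_def field_simps)
  let ?I = "\<integral>x. f x powr p \<partial>gauss_noise \<sigma>"
  let ?m = "exp (\<alpha> * (\<alpha> - 1) * (norm c)\<^sup>2 / (2 * \<sigma>\<^sup>2))"
  note T = has_bochner_integral_gauss_tilt[OF \<sigma>, of "\<alpha> *\<^sub>R c"]
  have "(\<integral>x. f (x + c) \<partial>gauss_noise \<sigma>) = (\<integral>x. f x * gauss_tilt \<sigma> c x \<partial>gauss_noise \<sigma>)"
    by (rule integral_gauss_noise_shift[OF f])
  also have "\<dots> \<le> ?I powr (1 / p) * (\<integral>x. gauss_tilt \<sigma> c x powr \<alpha> \<partial>gauss_noise \<sigma>) powr (1 / \<alpha>)"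
  proof (rule integral_Holder)
    show "integrable (gauss_noise \<sigma>) (\<lambda>x. f x powr p)"
      using bnd p by (intro integrable_const_bound[of _ "B powr p"]) (auto intro!: powr_mono2)
    show "integrable (gauss_noise \<sigma>) (\<lambda>x. gauss_tilt \<sigma> c x powr \<alpha>)"
      using T unfolding gauss_tilt_powr by (auto simp: has_bochner_integral_iff)
  qed (use p \<alpha> bnd in auto)
  also have "(\<integral>x. gauss_tilt \<sigma> c x powr \<alpha> \<partial>gauss_noise \<sigma>) = ?m"
    using T unfolding gauss_tilt_powr by (simp add: has_bochner_integral_iff)
  finally have "(\<integral>x. f (x + c) \<partial>gauss_noise \<sigma>) powr p \<le> (?I powr (1 / p) * ?m powr (1 / \<alpha>)) powr p"
    using p bnd by (intro powr_mono2) auto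
  also have "\<dots> = ?I * exp (\<alpha> * (norm c)\<^sup>2 / (2 * \<sigma>\<^sup>2))"
  proof -
    \<comment> \<open>The \<alpha>-th root followed by the \<open>p\<close>-th power turns the
      factor \<open>\<alpha> * (\<alpha> - 1)\<close> of the exponent into \<alpha>.\<close>
    have "1 / \<alpha> * p * (\<alpha> * (\<alpha> - 1)) = \<alpha>" using \<alpha> by (simp add: p_def)
    then have "?m powr (1 / \<alpha> * p) = exp (\<alpha> * (norm c)\<^sup>2 / (2 * \<sigma>\<^sup>2))"
      using \<alpha> by (simp add: exp_powr_real p_def)
    then show ?thesis using p by (simp add: powr_mult powr_powr)
  qed
  finally show ?thesis by (simp add: p_def mult.commute)
qed

section \<open>Renyi divergence from dual inequalities\<close>

text \<open>Two kinds of test functions suffice: indicators of null sets give absolute continuity,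
  and powers \<alpha> - 1 of the truncated density, modelled on the extremal functions in Hoelder's
  inequality, bound the \<alpha>-th moment.\<close>

lemma renyi_div_leI:
  fixes \<mu> \<nu> :: "'a measure"
  assumes \<mu>: "prob_space \<mu>" and \<nu>: "prob_space \<nu>" and sets_eq: "sets \<mu> = sets \<nu>"
    and \<alpha>: "\<alpha> > 1" and \<epsilon>: "\<epsilon> \<ge> 0"
    and dual: "\<And>f B. f \<in> borel_measurable \<nu> \<Longrightarrow> (\<And>x. 0 \<le> f x) \<Longrightarrow> (\<And>x. f x \<le> B) \<Longrightarrow>
      (\<integral>x. f x \<partial>\<mu>) powr (\<alpha> / (\<alpha> - 1)) \<le> exp \<epsilon> * (\<integral>x. f x powr (\<alpha> / (\<alpha> - 1)) \<partial>\<nu>)"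
  shows "renyi_div \<alpha> \<mu> \<nu> \<le> ereal \<epsilon>"
proof -
  interpret \<mu>: prob_space \<mu> by fact
  interpret \<nu>: prob_space \<nu> by fact
  define p where "p = \<alpha> / (\<alpha> - 1)"
  have p: "p > 1" "(\<alpha> - 1) * p = \<alpha>" "p - 1 = 1 / (\<alpha> - 1)" using \<alpha> by (auto simp: p_def field_simps)
  note [measurable_cong] = sets_eq
  have ac: "absolutely_continuous \<nu> \<mu>"
    unfolding absolutely_continuous_def
  proof
    fix N assume N: "N \<in> null_sets \<nu>"
    then have [measurable]: "N \<in> sets \<nu>" by auto
    have ip: "indicator N x powr p = (indicator N x :: real)" for x
      by (simp add: indicator_def)
    have "measure \<mu> N powr p \<le> exp \<epsilon> * measure \<nu> N"
      using dual[of "indicator N" 1] sets_eq by (simp add: ip p_def[symmetric])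
    also have "measure \<nu> N = 0" using N by (simp add: measure_eq_0_null_sets)
    finally have "measure \<mu> N = 0" using measure_nonneg[of \<mu> N]
      by (smt (verit) mult_zero_right powr_gt_zero)
    then show "N \<in> null_sets \<mu>" using sets_eq by (simp add: \<mu>.emeasure_eq_measure null_sets_def)
  qed
  define \<rho> where "\<rho> = RN_deriv \<nu> \<mu>"
  define r where "r = (\<lambda>x. enn2real (\<rho> x))"
  have [measurable]: "\<rho> \<in> borel_measurable \<nu>" by (simp add: \<rho>_def)
  have r_meas [measurable]: "r \<in> borel_measurable \<nu>" by (simp add: r_def)
  have r0: "0 \<le> r x" for x by (simp add: r_def)
  \<comment> \<open>Truncating at \<open>N\<close> keeps the test functions bounded and the moment
    finite, which allows dividing by it below.\<close>
  define I where "I = (\<lambda>N::nat. \<integral>x. min (r x) N powr \<alpha> \<partial>\<nu>)"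
  have int: "integrable \<nu> (\<lambda>x. min (r x) (real N) powr \<alpha>)" for N
    using r0 \<alpha> by (intro \<nu>.integrable_const_bound[of _ "real N powr \<alpha>"]) (auto intro!: powr_mono2)
  have I0: "0 \<le> I N" for N by (simp add: I_def)
  have I_le: "I N \<le> exp ((\<alpha> - 1) * \<epsilon>)" for N
  proof (cases "I N = 0")
    case False
    then have pos: "I N > 0" using I0[of N] by simp
    \<comment> \<open>The exponent is chosen so that \<open>(\<alpha> - 1) * p = \<alpha>\<close>:
      the \<open>p\<close>-th power of \<open>?f\<close> integrates to \<open>I N\<close>
      again.\<close>
    let ?f = "\<lambda>x. min (r x) (real N) powr (\<alpha> - 1)"
    have fb: "?f x \<le> real N powr (\<alpha> - 1)" for x
      using r0 \<alpha> by (intro powr_mono2) auto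
    have intf: "integrable \<mu> ?f"
      using fb by (intro \<mu>.integrable_const_bound[of _ "real N powr (\<alpha> - 1)"]) auto
    have "ennreal (I N) = (\<integral>\<^sup>+x. ennreal (min (r x) N powr \<alpha>) \<partial>\<nu>)"
      unfolding I_def using int by (subst nn_integral_eq_integral) auto
    also have "\<dots> \<le> (\<integral>\<^sup>+x. \<rho> x * ennreal (?f x) \<partial>\<nu>)"
    proof (rule nn_integral_mono)
      fix x
      have m0: "0 \<le> min (r x) (real N)" using r0 by simp
      have "min (r x) (real N) powr \<alpha> = min (r x) (real N) * ?f x"
        using powr_mult_base[OF m0, of "\<alpha> - 1"] by simp
      also have "\<dots> \<le> r x * ?f x" by (intro mult_right_mono) auto
      finally have "ennreal (min (r x) (real N) powr \<alpha>) \<le> ennreal (r x * ?f x)"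
        by (rule ennreal_leI)
      also have "\<dots> = ennreal (r x) * ennreal (?f x)" using r0 by (simp add: ennreal_mult)
      \<comment> \<open>\<open>enn2real\<close> sends infinity to 0, so \<open>r\<close> is at most
        \<open>\<rho>\<close> everywhere.\<close>
      also have "\<dots> \<le> \<rho> x * ennreal (?f x)"
        unfolding r_def by (intro mult_right_mono) (auto simp: ennreal_enn2real_if)
      finally show "ennreal (min (r x) (real N) powr \<alpha>) \<le> \<rho> x * ennreal (?f x)" .
    qed
    also have "\<dots> = (\<integral>\<^sup>+x. ennreal (?f x) \<partial>\<mu>)"
      unfolding \<rho>_def using ac sets_eq by (intro \<nu>.RN_deriv_nn_integral[symmetric]) auto
    also have "\<dots> = ennreal (\<integral>x. ?f x \<partial>\<mu>)"
      using intf by (subst nn_integral_eq_integral) auto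
    finally have "I N \<le> (\<integral>x. ?f x \<partial>\<mu>)" using I0 by (simp add: ennreal_le_iff)
    then have "I N powr p \<le> (\<integral>x. ?f x \<partial>\<mu>) powr p" using I0 p by (intro powr_mono2) auto
    also have "\<dots> \<le> exp \<epsilon> * (\<integral>x. ?f x powr p \<partial>\<nu>)"
      unfolding p_def using fb by (intro dual) auto
    also have "(\<integral>x. ?f x powr p \<partial>\<nu>) = I N" by (simp add: I_def powr_powr p)
    \<comment> \<open>\<open>I N\<close> occurs on both sides; cancelling it leaves the power
      \<open>p - 1 = 1 / (\<alpha> - 1)\<close>.\<close>
    finally have "I N * I N powr (p - 1) \<le> I N * exp \<epsilon>"
      using pos by (simp add: powr_mult_base mult.commute)
    then have "I N powr (p - 1) \<le> exp \<epsilon>" using pos by simp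
    then have "(I N powr (p - 1)) powr (\<alpha> - 1) \<le> exp \<epsilon> powr (\<alpha> - 1)"
      using \<alpha> by (intro powr_mono2) auto
    then show ?thesis using pos \<alpha> p(3) by (simp add: powr_powr exp_powr_real mult.commute)
  qed simp
  have "(\<integral>\<^sup>+x. ennreal (r x powr \<alpha>) \<partial>\<nu>) = (\<integral>\<^sup>+x. (SUP N::nat. ennreal (min (r x) (real N) powr \<alpha>)) \<partial>\<nu>)"
  proof (rule nn_integral_cong)
    fix x
    obtain N where N: "r x \<le> real N" using real_arch_simple by blast
    show "ennreal (r x powr \<alpha>) = (SUP N::nat. ennreal (min (r x) (real N) powr \<alpha>))"
    proof (rule antisym)
      show "ennreal (r x powr \<alpha>) \<le> (SUP N::nat. ennreal (min (r x) (real N) powr \<alpha>))"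
        by (rule SUP_upper2[of N]) (use N in auto)
      show "(SUP N::nat. ennreal (min (r x) (real N) powr \<alpha>)) \<le> ennreal (r x powr \<alpha>)"
        using r0 \<alpha> by (intro SUP_least ennreal_leI powr_mono2) auto
    qed
  qed
  also have "\<dots> = (SUP N::nat. \<integral>\<^sup>+x. ennreal (min (r x) (real N) powr \<alpha>) \<partial>\<nu>)"
    using r0 \<alpha> by (intro nn_integral_monotone_convergence_SUP)
      (auto simp: incseq_def le_fun_def intro!: ennreal_leI powr_mono2)
  also have "\<dots> = (SUP N. ennreal (I N))"
    unfolding I_def using int by (subst nn_integral_eq_integral) auto
  also have "\<dots> \<le> ennreal (exp ((\<alpha> - 1) * \<epsilon>))"
    by (intro SUP_least ennreal_leI I_le)
  finally have le: "(\<integral>\<^sup>+x. ennreal (r x powr \<alpha>) \<partial>\<nu>) \<le> ennreal (exp ((\<alpha> - 1) * \<epsilon>))" (is "?J \<le> _") .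
  then have fin: "?J \<noteq> \<infinity>" by (auto simp: top_unique)
  have "enn2real ?J \<le> exp ((\<alpha> - 1) * \<epsilon>)" using le by (intro enn2real_leI) auto
  \<comment> \<open>The value 0 is harmless since \<open>ln 0 = 0\<close> and \<epsilon> \<ge>
    0.\<close>
  then have "ln (enn2real ?J) \<le> (\<alpha> - 1) * \<epsilon>"
    using \<alpha> \<epsilon> ln_mono[of "enn2real ?J" "exp ((\<alpha> - 1) * \<epsilon>)"]
    by (cases "enn2real ?J = 0") (auto simp: less_le)
  then have "ln (enn2real ?J) / (\<alpha> - 1) \<le> \<epsilon>" using \<alpha> by (simp add: field_simps)
  then show ?thesis
    using sets_eq ac fin by (simp add: renyi_div_def r_def \<rho>_def Let_def)
qed

section \<open>Clipping and the gradient step\<close>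

text \<open>Outside the ball the radial point has distance \<open>norm v - K\<close>, the least
  possible by the triangle inequality. Nonexpansiveness and continuity of clipping are then
  inherited from projections onto convex sets.\<close>

lemma clipK_eq_closest_point:
  assumes "0 \<le> K"
  shows "clipK K v = closest_point (cball 0 K) v"
proof (rule closest_point_unique)
  show "clipK K v \<in> cball 0 K" using assms by (auto simp: clipK_def)
  show "\<forall>z\<in>cball 0 K. dist v (clipK K v) \<le> dist v z"
  proof
    fix z :: 'a assume z: "z \<in> cball 0 K"
    show "dist v (clipK K v) \<le> dist v z"
    proof (cases "norm v \<le> K")
      case False
      then have pos: "norm v > 0" using assms by linarith
      have "v - (K / norm v) *\<^sub>R v = (1 - K / norm v) *\<^sub>R v" by (simp add: algebra_simps)
      then have "dist v (clipK K v) = \<bar>1 - K / norm v\<bar> * norm v"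
        using False by (simp add: dist_norm clipK_def)
      also have "\<dots> = norm v - K"
        using False pos by (simp add: field_simps)
      also have "\<dots> \<le> dist v z" using z norm_triangle_ineq2[of v z] by (simp add: dist_norm)
      finally show ?thesis .
    qed (simp add: clipK_def)
  qed
qed auto

lemma norm_clipK_le: "0 \<le> K \<Longrightarrow> norm (clipK K v) \<le> K"
  by (auto simp: clipK_def)

lemma norm_clipK_diff_le:
  assumes "0 \<le> K"
  shows "norm (clipK K u - clipK K v) \<le> norm (u - v)"
  using closest_point_lipschitz[of "cball 0 K" u v] assms
  by (simp add: clipK_eq_closest_point dist_norm)

text \<open>The residual of clipping has norm \<open>max 0 (norm u - K)\<close>. In the application
  the radius is the noise shift allowed in one step rather than the gradient bound.\<close>

lemma norm_minus_clipK_le: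
  assumes "0 \<le> K" "0 \<le> r" "norm u \<le> r + K"
  shows "norm (u - clipK K u) \<le> r"
proof (cases "norm u \<le> K")
  case False
  then have pos: "norm u > 0" using assms by linarith
  have "u - (K / norm u) *\<^sub>R u = (1 - K / norm u) *\<^sub>R u" by (simp add: algebra_simps)
  then have "norm (u - clipK K u) = \<bar>1 - K / norm u\<bar> * norm u"
    using False by (simp add: clipK_def)
  also have "\<dots> = norm u - K" using False pos by (simp add: field_simps)
  finally show ?thesis using assms by simp
qed (use assms in \<open>simp add: clipK_def\<close>)

text \<open>The centre of the next iterate before noise and projection.\<close>

definition gd_map :: "('x \<Rightarrow> 'a \<Rightarrow> 'a) \<Rightarrow> real \<Rightarrow> real \<Rightarrow> nat \<Rightarrow> (nat \<Rightarrow> 'x) \<Rightarrow> 'a::euclidean_space \<Rightarrow> 'a" where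
  "gd_map grad K \<eta> n ds w = w - \<eta> *\<^sub>R ((1 / real n) *\<^sub>R (\<Sum>i<n. clipK K (grad (ds i) w)))"

text \<open>\<open>S\<close> bounds the average discrepancy per sample; it comes once from Hoelder
  continuity and once from clipping alone.\<close>

lemma norm_gd_map_diff_le:
  assumes "\<eta> > 0" "n \<ge> 1"
    and S: "(\<Sum>i<n. norm (clipK K (grad (ds i) w) - clipK K (grad (ds' i) z))) \<le> real n * S"
  shows "norm (gd_map grad K \<eta> n ds w - gd_map grad K \<eta> n ds' z) \<le> norm (w - z) + \<eta> * S"
proof -
  let ?d = "\<Sum>i<n. clipK K (grad (ds i) w) - clipK K (grad (ds' i) z)"
  have "gd_map grad K \<eta> n ds w - gd_map grad K \<eta> n ds' z = (w - z) - (\<eta> / real n) *\<^sub>R ?d"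
    by (simp add: gd_map_def sum_subtractf algebra_simps)
  then have "norm (gd_map grad K \<eta> n ds w - gd_map grad K \<eta> n ds' z) \<le> norm (w - z) + \<eta> / real n * norm ?d"
    using norm_triangle_ineq4[of "w - z" "(\<eta> / real n) *\<^sub>R ?d"] assms by simp
  also have "\<eta> / real n * norm ?d \<le> \<eta> / real n * (real n * S)"
    using assms by (intro mult_left_mono order.trans[OF norm_sum S]) auto
  also have "\<dots> = \<eta> * S" using assms by simp
  finally show ?thesis by simp
qed

section \<open>The functions g and h, and the weighted splitting of squares\<close>

lemma gfun_mono:
  assumes "\<eta> \<ge> 0" "L \<ge> 0" "lam > 0" "0 \<le> x" "x \<le> y"
  shows "gfun \<eta> L lam x \<le> gfun \<eta> L lam y"
  unfolding gfun_def using assms by (intro add_mono mult_left_mono powr_mono2) auto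

text \<open>Existence is the intermediate value theorem on \<open>{0..y}\<close>, since g(0) = 0 and
  g(y) \<ge> y. Uniqueness holds because the identity summand makes g strictly increasing even for
  \<open>L = 0\<close>.\<close>

lemma hfun_inverse:
  assumes "\<eta> \<ge> 0" "L \<ge> 0" "lam > 0" "y \<ge> 0"
  shows "0 \<le> hfun \<eta> L lam y" "gfun \<eta> L lam (hfun \<eta> L lam y) = y"
proof -
  have cont: "continuous_on {0..y} (gfun \<eta> L lam)"
    unfolding gfun_def[abs_def] using assms by (intro continuous_intros continuous_on_powr') auto
  have "gfun \<eta> L lam 0 \<le> y" "y \<le> gfun \<eta> L lam y" using assms by (auto simp: gfun_def)
  then obtain x where x: "0 \<le> x" "gfun \<eta> L lam x = y"
    using IVT'[of "gfun \<eta> L lam" 0 y y] cont assms by auto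
  have strict: "gfun \<eta> L lam u < gfun \<eta> L lam v" if "0 \<le> u" "u < v" for u v
    unfolding gfun_def using assms that by (intro add_less_le_mono mult_left_mono powr_mono2) auto
  have "\<exists>!x. 0 \<le> x \<and> gfun \<eta> L lam x = y"
    using x strict by (intro ex1I[of _ x]) (auto, metis less_irrefl linorder_neqE_linordered_idom)
  from theI'[OF this] show "0 \<le> hfun \<eta> L lam y" "gfun \<eta> L lam (hfun \<eta> L lam y) = y"
    by (auto simp: hfun_def)
qed

lemma Abk_hfun_nonneg:
  assumes "\<eta> \<ge> 0" "L \<ge> 0" "lam > 0" "\<And>t. T - k \<le> t \<Longrightarrow> t < T \<Longrightarrow> 0 \<le> a t" "k \<le> T"
  shows "0 \<le> Abk (hfun \<eta> L lam) a T k"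
  using assms(4,5)
proof (induction k)
  case (Suc k)
  then have "0 \<le> Abk (hfun \<eta> L lam) a T k" "0 \<le> a (T - Suc k)" by auto
  then show ?case using assms(1-3) by (auto intro!: hfun_inverse)
qed simp

text \<open>For \<beta> strictly between 0 and 1 the difference of the sides is a square over a
  positive number. At the end points the division convention makes the right side infinite or
  reduces the claim to an equality.\<close>

lemma square_add_le_ediv:
  assumes "0 \<le> \<beta>" "\<beta> \<le> 1" "0 \<le> s" "0 \<le> a"
  shows "ereal ((s + a)\<^sup>2) \<le> ediv (s\<^sup>2) \<beta> + ediv (a\<^sup>2) (1 - \<beta>)"
proof -
  consider "\<beta> = 0" | "\<beta> = 1" | "0 < \<beta>" "\<beta> < 1" using assms by linarith
  then show ?thesis
  proof cases
    case 1
    then show ?thesis using assms by (cases "s = 0") (auto simp: ediv_def)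
  next
    case 2
    then show ?thesis using assms by (cases "a = 0") (auto simp: ediv_def)
  next
    case 3
    have "s\<^sup>2 / \<beta> + a\<^sup>2 / (1 - \<beta>) - (s + a)\<^sup>2 = ((1 - \<beta>) * s - \<beta> * a)\<^sup>2 / (\<beta> * (1 - \<beta>))"
      using 3 by (simp add: field_simps power2_eq_square)
    also have "\<dots> \<ge> 0" using 3 by simp
    finally have "(s + a)\<^sup>2 \<le> s\<^sup>2 / \<beta> + a\<^sup>2 / (1 - \<beta>)" by simp
    then show ?thesis using 3 by (simp add: ediv_def)
  qed
qed

section \<open>Noisy-SGD as a Markov kernel\<close>

locale holder_noisy_sgd =
  fixes Ks :: "'a::euclidean_space set" and grad :: "'x \<Rightarrow> 'a \<Rightarrow> 'a"
    and K \<eta> \<sigma> L lam :: real and n :: nat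
  assumes Ks: "Ks \<noteq> {}" "closed Ks" "convex Ks"
    and holder: "\<And>d w w'. w \<in> Ks \<Longrightarrow> w' \<in> Ks \<Longrightarrow>
                   norm (grad d w - grad d w') \<le> L * norm (w - w') powr lam"
    and L: "L \<ge> 0" and lam: "0 < lam"
    and params: "K > 0" "\<eta> > 0" "\<sigma> > 0" "n \<ge> 1"
begin

abbreviation "gd \<equiv> gd_map grad K \<eta> n"
abbreviation "step \<equiv> sgd_step Ks grad K \<eta> \<sigma> n"
abbreviation "proj \<equiv> closest_point Ks"

lemma proj_in: "proj x \<in> Ks"
  using Ks by (intro closest_point_in_set) auto

lemma norm_proj_diff_le: "norm (proj x - proj y) \<le> norm (x - y)"
  using closest_point_lipschitz[of Ks x y] Ks by (simp add: dist_norm)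

lemma borel_measurable_proj [measurable]: "proj \<in> borel_measurable borel"
  using Ks by (intro borel_measurable_continuous_onI continuous_on_closest_point) auto

text \<open>Serves the measurability of the kernel in the starting point.\<close>

lemma continuous_on_grad: "continuous_on Ks (grad d)"
  unfolding continuous_on_def
proof
  fix w assume w: "w \<in> Ks"
  have "((\<lambda>x. L * norm (x - w) powr lam) \<longlongrightarrow> L * norm (w - w) powr lam) (at w within Ks)"
    using lam by (intro tendsto_intros) auto
  then have "((\<lambda>x. L * norm (x - w) powr lam) \<longlongrightarrow> 0) (at w within Ks)"
    using lam by simp
  then have "((\<lambda>x. grad d x - grad d w) \<longlongrightarrow> 0) (at w within Ks)"
    by (rule Lim_null_comparison[rotated]) (auto simp: eventually_at_filter intro!: always_eventually holder w)
  then show "(grad d \<longlongrightarrow> grad d w) (at w within Ks)"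
    by (simp add: LIM_zero_iff)
qed

lemma continuous_on_gd: "continuous_on Ks (gd ds)"
proof -
  have "continuous_on UNIV (clipK K :: 'a \<Rightarrow> 'a)"
  proof (rule continuous_on_cong[THEN iffD1, OF refl])
    show "continuous_on UNIV (closest_point (cball 0 K) :: 'a \<Rightarrow> 'a)"
      using params by (intro continuous_on_closest_point) auto
  qed (use params in \<open>simp add: clipK_eq_closest_point\<close>)
  then have "continuous_on Ks (\<lambda>w. clipK K (grad d w))" for d
    by (rule continuous_on_compose2[OF _ continuous_on_grad]) auto
  then show ?thesis
    unfolding gd_map_def[abs_def] by (intro continuous_intros) auto
qed

lemma step_in: "w \<in> Ks \<Longrightarrow> step ds w = distr (gauss_noise \<sigma>) borel (\<lambda>G. proj (gd ds w + G))"
  by (simp add: sgd_step_def gd_map_def)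

lemma sets_step [simp, measurable_cong]: "sets (step ds w) = sets borel"
  by (simp add: sgd_step_def)

lemma prob_space_step: "prob_space (step ds w)"
proof -
  interpret prob_space "gauss_noise \<sigma> :: 'a measure" by (rule prob_space_gauss_noise) (use params in simp)
  show ?thesis
  proof (cases "w \<in> Ks")
    case True
    then show ?thesis unfolding step_in[OF True] by (intro prob_space_distr) measurable
  next
    case False
    then show ?thesis by (auto simp: sgd_step_def intro!: prob_space_return)
  qed
qed

lemma measurable_step [measurable]: "step ds \<in> borel \<rightarrow>\<^sub>M subprob_algebra borel"
proof -
  have Ks_sets [measurable]: "Ks \<in> sets borel" using Ks by auto
  \<comment> \<open>Continuity of \<open>gd ds\<close> is available on \<open>Ks\<close>; the value
    0 elsewhere makes a Borel function on the whole space and is discarded by the case distinction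
    of the kernel.\<close>
  define \<psi> where "\<psi> = (\<lambda>w. if w \<in> Ks then gd ds w else 0)"
  have [measurable]: "\<psi> \<in> borel_measurable borel"
    unfolding \<psi>_def using continuous_on_gd by (intro borel_measurable_continuous_on_if) auto
  have g: "gauss_noise \<sigma> \<in> space (subprob_algebra (borel :: 'a measure))"
    using params
    by (auto simp: space_subprob_algebra intro!: prob_space_imp_subprob_space prob_space_gauss_noise)
  have "(\<lambda>w. distr (gauss_noise \<sigma>) borel (\<lambda>G. proj (\<psi> w + G))) \<in> borel \<rightarrow>\<^sub>M subprob_algebra borel"
    using g by (intro measurable_distr2[where M=borel]) (auto intro: measurable_const)
  then have "(\<lambda>w. if w \<in> Ks then distr (gauss_noise \<sigma>) borel (\<lambda>G. proj (\<psi> w + G)) else return borel w)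
      \<in> borel \<rightarrow>\<^sub>M subprob_algebra borel"
    by (intro measurable_If) auto
  also have "(\<lambda>w. if w \<in> Ks then distr (gauss_noise \<sigma>) borel (\<lambda>G. proj (\<psi> w + G)) else return borel w) = step ds"
    by (auto simp: fun_eq_iff \<psi>_def step_in) (simp add: sgd_step_def)
  finally show ?thesis .
qed

text \<open>The Markov operator of one step. Its \<open>k\<close>-th iterate maps \<open>w\<close>
  to the expectation of \<open>f\<close> after \<open>k\<close> steps from \<open>w\<close>, the
  form in which the dual inequality is propagated.\<close>

definition avg :: "(nat \<Rightarrow> 'x) \<Rightarrow> ('a \<Rightarrow> real) \<Rightarrow> 'a \<Rightarrow> real" where
  "avg ds f w = (\<integral>x. f x \<partial>step ds w)"

lemma avg_in:
  assumes "f \<in> borel_measurable borel" "w \<in> Ks"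
  shows "avg ds f w = (\<integral>G. f (proj (gd ds w + G)) \<partial>gauss_noise \<sigma>)"
  unfolding avg_def step_in[OF assms(2)] using assms(1) by (subst integral_distr) auto

text \<open>The bound \<open>B\<close> is explicit because \<open>avg\<close> preserves it, which
  keeps all iterates integrable.\<close>

definition admissible :: "real \<Rightarrow> ('a \<Rightarrow> real) \<Rightarrow> bool" where
  "admissible B f \<longleftrightarrow> f \<in> borel_measurable borel \<and> (\<forall>x. 0 \<le> f x \<and> f x \<le> B)"

lemma admissible_avg:
  assumes "admissible B f"
  shows "admissible B (avg ds f)"
proof -
  have [measurable]: "f \<in> borel_measurable borel" and b: "\<And>x. 0 \<le> f x" "\<And>x. f x \<le> B"
    using assms by (auto simp: admissible_def)
  have "avg ds f w \<le> B" for w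
  proof -
    interpret prob_space "step ds w" by (rule prob_space_step)
    have "integrable (step ds w) f"
      using b by (intro integrable_const_bound[of _ B]) auto
    then show ?thesis unfolding avg_def using b by (intro integral_le_const) auto
  qed
  moreover have "avg ds f \<in> borel_measurable borel"
    unfolding avg_def[abs_def] by measurable
  ultimately show ?thesis
    using b by (auto simp: admissible_def avg_def)
qed

lemma admissible_funpow_avg: "admissible B f \<Longrightarrow> admissible B ((avg ds ^^ k) f)"
  by (induction k) (auto intro: admissible_avg)

lemma noisy_sgd_prob_space:
  "prob_space (noisy_sgd Ks grad K \<eta> \<sigma> n ds W0 t) \<and> sets (noisy_sgd Ks grad K \<eta> \<sigma> n ds W0 t) = sets borel"
proof (induction t)
  case 0
  then show ?case by (auto intro!: prob_space_return)
next
  case (Suc t)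
  interpret prob_space "noisy_sgd Ks grad K \<eta> \<sigma> n ds W0 t" using Suc by simp
  have [measurable_cong]: "sets (noisy_sgd Ks grad K \<eta> \<sigma> n ds W0 t) = sets borel" using Suc by simp
  have "prob_space (noisy_sgd Ks grad K \<eta> \<sigma> n ds W0 (Suc t))"
    unfolding noisy_sgd.simps by (intro prob_space_bind[where S=borel]) (auto intro: prob_space_step)
  moreover have "sets (noisy_sgd Ks grad K \<eta> \<sigma> n ds W0 (Suc t)) = sets borel"
    unfolding noisy_sgd.simps by (intro sets_bind) (auto simp: not_empty)
  ultimately show ?case by simp
qed

text \<open>Pulling the test function back replaces laws by iterated expectations. The last step of
  the chain is the first application of \<open>avg\<close>, hence the induction over arbitrary
  \<open>f\<close>.\<close>

lemma integral_noisy_sgd: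
  "admissible B f \<Longrightarrow> (\<integral>x. f x \<partial>noisy_sgd Ks grad K \<eta> \<sigma> n ds W0 t) = (avg ds ^^ t) f W0"
proof (induction t arbitrary: f)
  case 0
  then show ?case by (auto simp: admissible_def integral_return)
next
  case (Suc t)
  let ?M = "noisy_sgd Ks grad K \<eta> \<sigma> n ds W0 t"
  interpret prob_space ?M using noisy_sgd_prob_space by blast
  have [measurable_cong]: "sets ?M = sets borel" using noisy_sgd_prob_space by blast
  have "(\<integral>x. f x \<partial>(?M \<bind> step ds)) = (\<integral>w. avg ds f w \<partial>?M)"
    unfolding avg_def
  proof (rule integral_bind[where K=borel and B=B and B'=1])
    show "AE x in ?M. emeasure (step ds x) (space (step ds x)) \<le> ennreal 1"
      by (auto simp: prob_space.emeasure_space_1[OF prob_space_step])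
  qed (use Suc.prems in \<open>auto simp: admissible_def\<close>)
  also have "\<dots> = (avg ds ^^ t) (avg ds f) W0"
    by (rule Suc.IH[OF admissible_avg[OF Suc.prems]])
  finally show ?case by (simp add: funpow_swap1)
qed

section \<open>Comparison of two chains over one step\<close>

text \<open>The noise \<open>G\<close> of one chain is coupled with \<open>G + c\<close> in the
  other: a pointwise inequality along this coupling integrates to one between expectations, at the
  price of a Gaussian shift by \<open>c\<close>.\<close>

lemma avg_powr_le:
  assumes \<alpha>: "\<alpha> > 1" and w: "w \<in> Ks" and z: "z \<in> Ks" and C: "C \<ge> 0"
    and f: "admissible B f" and g: "admissible B' g"
    and le: "\<And>G. f (proj (gd ds w + G)) powr (\<alpha> / (\<alpha> - 1)) \<le> C * g (proj (gd ds' z + (G + c)))"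
  shows "avg ds f w powr (\<alpha> / (\<alpha> - 1)) \<le> exp (\<alpha> * (norm c)\<^sup>2 / (2 * \<sigma>\<^sup>2)) * (C * avg ds' g z)"
proof -
  interpret prob_space "gauss_noise \<sigma> :: 'a measure" by (rule prob_space_gauss_noise) (use params in simp)
  have [measurable]: "f \<in> borel_measurable borel" "g \<in> borel_measurable borel"
    and fb: "\<And>x. 0 \<le> f x" "\<And>x. f x \<le> B" and gb: "\<And>x. 0 \<le> g x" "\<And>x. g x \<le> B'"
    using f g by (auto simp: admissible_def)
  define p where "p = \<alpha> / (\<alpha> - 1)"
  have p: "p > 1" using \<alpha> by (simp add: p_def)
  \<comment> \<open>The \<open>p\<close>-th root of the right-hand side of \<open>le\<close>: it
    dominates \<open>f\<close> along the coupling, and its \<open>p\<close>-th power integrates to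
    \<open>C * avg ds' g z\<close>.\<close>
  define h where "h = (\<lambda>y. (C * g (proj (gd ds' z + y))) powr (1 / p))"
  have [measurable]: "h \<in> borel_measurable borel" unfolding h_def by measurable
  have hb: "0 \<le> h y" "h y \<le> (C * B') powr (1 / p)" for y
    using C gb p by (auto simp: h_def intro!: powr_mono2 mult_left_mono)
  have hp: "h y powr p = C * g (proj (gd ds' z + y))" for y
    using C gb p by (simp add: h_def powr_powr)
  have fh: "f (proj (gd ds w + G)) \<le> h (G + c)" for G
  proof -
    have "f (proj (gd ds w + G)) = (f (proj (gd ds w + G)) powr p) powr (1 / p)"
      using fb p by (simp add: powr_powr)
    also have "\<dots> \<le> h (G + c)"
      unfolding h_def using le p by (intro powr_mono2) (auto simp flip: p_def)
    finally show ?thesis .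
  qed
  have "avg ds f w \<le> (\<integral>G. h (G + c) \<partial>gauss_noise \<sigma>)"
    unfolding avg_in[OF \<open>f \<in> borel_measurable borel\<close> w]
  proof (rule integral_mono)
    show "integrable (gauss_noise \<sigma>) (\<lambda>G. f (proj (gd ds w + G)))"
      using fb by (intro integrable_const_bound[of _ B]) auto
    show "integrable (gauss_noise \<sigma>) (\<lambda>G. h (G + c))"
      using hb by (intro integrable_const_bound[of _ "(C * B') powr (1 / p)"]) auto
  qed (rule fh)
  then have "avg ds f w powr p \<le> (\<integral>G. h (G + c) \<partial>gauss_noise \<sigma>) powr p"
    using p fb by (intro powr_mono2) (auto simp: avg_def)
  also have "\<dots> \<le> exp (\<alpha> * (norm c)\<^sup>2 / (2 * \<sigma>\<^sup>2)) * (\<integral>G. h G powr p \<partial>gauss_noise \<sigma>)"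
    unfolding p_def using hb params \<alpha> by (intro gauss_noise_shift_powr_le) auto
  also have "(\<integral>G. h G powr p \<partial>gauss_noise \<sigma>) = C * avg ds' g z"
    unfolding hp using z by (simp add: avg_in)
  finally show ?thesis by (simp add: p_def)
qed

text \<open>Clipping is nonexpansive, so each sample contributes at most the Hoelder modulus. Sample
  \<open>i\<close> adds at most \<open>2 * K\<close> for exchanging the data point while staying at
  \<open>z\<close>, and averaging divides this by \<open>n\<close>.\<close>

lemma norm_gd_diff_le_holder:
  assumes i: "i < n" "\<forall>j<n. j \<noteq> i \<longrightarrow> ds j = ds' j" and w: "w \<in> Ks" and z: "z \<in> Ks"
  shows "norm (gd ds w - gd ds' z) \<le> gfun \<eta> L lam (norm (w - z)) + 2 * \<eta> * K / real n"
proof -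
  let ?h = "L * norm (w - z) powr lam"
  have lip: "norm (clipK K (grad d w) - clipK K (grad d z)) \<le> ?h" for d
    using norm_clipK_diff_le[of K "grad d w" "grad d z"] holder[OF w z, of d] params by simp
  have "norm (clipK K (grad (ds j) w) - clipK K (grad (ds' j) z)) \<le> ?h + (if j = i then 2 * K else 0)"
    if "j < n" for j
  proof (cases "j = i")
    case True
    have "norm (clipK K (grad (ds j) w) - clipK K (grad (ds' j) z)) \<le>
        norm (clipK K (grad (ds j) w) - clipK K (grad (ds j) z)) +
        (norm (clipK K (grad (ds j) z)) + norm (clipK K (grad (ds' j) z)))"
      by norm
    also have "\<dots> \<le> ?h + (K + K)"
      using params by (intro add_mono lip norm_clipK_le) auto
    finally show ?thesis using True by simp
  next
    case False
    then show ?thesis using i that lip by simp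
  qed
  then have "(\<Sum>j<n. norm (clipK K (grad (ds j) w) - clipK K (grad (ds' j) z))) \<le>
      (\<Sum>j<n. ?h + (if j = i then 2 * K else 0))"
    by (intro sum_mono) auto
  also have "\<dots> = real n * (?h + 2 * K / real n)"
    using i params by (simp add: sum.distrib algebra_simps)
  finally have "norm (gd ds w - gd ds' z) \<le> norm (w - z) + \<eta> * (?h + 2 * K / real n)"
    by (rule norm_gd_map_diff_le[OF params(2,4)])
  then show ?thesis by (simp add: gfun_def algebra_simps)
qed

text \<open>Any two clipped gradients are at most \<open>2 * K\<close> apart; this gives the second
  term of the minimum in \<open>Dseq\<close>.\<close>

lemma norm_gd_diff_le: "norm (gd ds w - gd ds' z) \<le> norm (w - z) + 2 * \<eta> * K"
proof -
  have "norm (clipK K u - clipK K v) \<le> 2 * K" for u v :: 'a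
    using norm_triangle_ineq4[of "clipK K u" "clipK K v"] norm_clipK_le[of K u] norm_clipK_le[of K v] params
    by simp
  then have "(\<Sum>j<n. norm (clipK K (grad (ds j) w) - clipK K (grad (ds' j) z))) \<le> (\<Sum>j<n. 2 * K)"
    by (intro sum_mono)
  also have "\<dots> = real n * (2 * K)" by simp
  finally show ?thesis
    using norm_gd_map_diff_le[OF params(2,4)] by (fastforce simp: algebra_simps)
qed

section \<open>Comparison over many steps, after and before time \<tau>\<close>

text \<open>Induction over the number \<open>k\<close> of remaining steps, with \<open>T - k\<close>
  the current time and the starting points arbitrary. For \<open>k = 0\<close> the distance bound is
  0, so both chains stand at the same point and the claim is \<open>fg\<close>.\<close>

lemma funpow_avg_powr_le_Abk:
  assumes \<alpha>: "\<alpha> > 1"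
    and adj: "i < n" "\<forall>j<n. j \<noteq> i \<longrightarrow> ds j = ds' j"
    and a: "\<And>t. T - k \<le> t \<Longrightarrow> t < T \<Longrightarrow> 0 \<le> a t" and k: "k \<le> T"
    and f: "admissible B f" and g: "admissible B' g" and fg: "\<And>x. f x powr (\<alpha> / (\<alpha> - 1)) = g x"
    and w: "w \<in> Ks" and z: "z \<in> Ks" and wz: "norm (w - z) \<le> Abk (hfun \<eta> L lam) a T k"
  shows "(avg ds ^^ k) f w powr (\<alpha> / (\<alpha> - 1)) \<le>
    exp (\<alpha> / (2 * \<sigma>\<^sup>2) * (\<Sum>t\<in>{T - k..<T}. (2 * \<eta> * K / real n + a t)\<^sup>2)) * (avg ds' ^^ k) g z"
  using a k w z wz
proof (induction k arbitrary: w z)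
  case 0
  then show ?case using fg by simp
next
  case (Suc k)
  let ?A = "Abk (hfun \<eta> L lam) a T" and ?s = "2 * \<eta> * K / real n" and ?t = "T - Suc k"
  \<comment> \<open>As \<open>Suc k \<le> T\<close>, the truncated subtraction is exact: the step is
    the one at time \<open>?t\<close>, and \<open>k\<close> steps remain after it.\<close>
  have T: "T - k = Suc ?t" using Suc.prems by auto
  have A0: "0 \<le> ?A k" using params L lam Suc.prems by (intro Abk_hfun_nonneg) auto
  have at: "0 \<le> a ?t" using Suc.prems by auto
  have s0: "0 \<le> ?s" using params by simp
  define u where "u = gd ds w - gd ds' z"
  \<comment> \<open>The part of the discrepancy of the two means that is absorbed into the noise of this step.\<close>
  define c where "c = clipK (?s + a ?t) u"
  have "norm u \<le> gfun \<eta> L lam (norm (w - z)) + ?s"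
    unfolding u_def using Suc.prems adj by (intro norm_gd_diff_le_holder) auto
  also have "gfun \<eta> L lam (norm (w - z)) \<le> gfun \<eta> L lam (?A (Suc k))"
    using Suc.prems params L lam by (intro gfun_mono) auto
  \<comment> \<open>\<open>?A (Suc k)\<close> is \<open>h (?A k + a ?t)\<close>, and g undoes
    h.\<close>
  also have "\<dots> = ?A k + a ?t"
    using hfun_inverse(2)[of \<eta> L lam "?A k + a ?t"] params L lam A0 at by simp
  finally have u: "norm u \<le> ?A k + (?s + a ?t)" by simp
  have uc: "norm (u - c) \<le> ?A k"
    unfolding c_def using u A0 at s0 by (intro norm_minus_clipK_le) auto
  have c: "norm c \<le> ?s + a ?t"
    unfolding c_def using at s0 by (intro norm_clipK_le) auto
  define e where "e = (\<lambda>k. \<alpha> / (2 * \<sigma>\<^sup>2) * (\<Sum>t\<in>{T - k..<T}. (?s + a t)\<^sup>2))"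
  have e_Suc: "e (Suc k) = \<alpha> * (?s + a ?t)\<^sup>2 / (2 * \<sigma>\<^sup>2) + e k"
    unfolding e_def T using Suc.prems
    by (subst sum.atLeast_Suc_lessThan) (auto simp: algebra_simps)
  have "(avg ds ^^ k) f (proj (gd ds w + G)) powr (\<alpha> / (\<alpha> - 1)) \<le>
      exp (e k) * (avg ds' ^^ k) g (proj (gd ds' z + (G + c)))" for G
    unfolding e_def
  proof (rule Suc.IH)
    \<comment> \<open>The common noise \<open>G\<close> cancels and the projection is nonexpansive,
      so the next iterates are at most \<open>norm (u - c)\<close> apart.\<close>
    have "norm (proj (gd ds w + G) - proj (gd ds' z + (G + c))) \<le> norm (gd ds w + G - (gd ds' z + (G + c)))"
      by (rule norm_proj_diff_le)
    also have "\<dots> = norm (u - c)" by (simp add: u_def algebra_simps)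
    finally show "norm (proj (gd ds w + G) - proj (gd ds' z + (G + c))) \<le> ?A k" using uc by simp
  qed (use Suc.prems in \<open>auto simp: proj_in\<close>)
  then have "avg ds ((avg ds ^^ k) f) w powr (\<alpha> / (\<alpha> - 1)) \<le>
      exp (\<alpha> * (norm c)\<^sup>2 / (2 * \<sigma>\<^sup>2)) * (exp (e k) * avg ds' ((avg ds' ^^ k) g) z)"
    using \<alpha> Suc.prems f g by (intro avg_powr_le) (auto intro: admissible_funpow_avg)
  also have "\<dots> \<le> exp (\<alpha> * (?s + a ?t)\<^sup>2 / (2 * \<sigma>\<^sup>2)) * (exp (e k) * avg ds' ((avg ds' ^^ k) g) z)"
  proof (rule mult_right_mono)
    have "(norm c)\<^sup>2 \<le> (?s + a ?t)\<^sup>2" using c by (intro power_mono) auto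
    then show "exp (\<alpha> * (norm c)\<^sup>2 / (2 * \<sigma>\<^sup>2)) \<le> exp (\<alpha> * (?s + a ?t)\<^sup>2 / (2 * \<sigma>\<^sup>2))"
      using \<alpha> by (auto intro!: divide_right_mono mult_left_mono)
    show "0 \<le> exp (e k) * avg ds' ((avg ds' ^^ k) g) z"
      using admissible_avg[OF admissible_funpow_avg[OF g]] by (auto simp: admissible_def)
  qed
  also have "\<dots> = exp (e (Suc k)) * avg ds' ((avg ds' ^^ k) g) z"
    by (simp add: e_Suc exp_add)
  finally show ?case by (simp add: e_def)
qed

text \<open>Both chains receive the same noise, so the constant \<open>C\<close> passes through
  unchanged. The induction lowers \<open>k\<close> and raises \<open>t\<close>, keeping the time
  \<open>t + k\<close> of the assumption \<open>init\<close> fixed.\<close>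

lemma funpow_avg_powr_le_Dseq:
  assumes \<alpha>: "\<alpha> > 1" and bounded: "bounded Ks" and D: "diameter Ks = D"
    and adj: "i < n" "\<forall>j<n. j \<noteq> i \<longrightarrow> ds j = ds' j"
    and f: "admissible B f" and g: "admissible B' g" and C: "C \<ge> 0"
    and init: "\<And>w z. w \<in> Ks \<Longrightarrow> z \<in> Ks \<Longrightarrow> norm (w - z) \<le> Dseq (gfun \<eta> L lam) \<eta> K n D (t + k) \<Longrightarrow>
        f w powr (\<alpha> / (\<alpha> - 1)) \<le> C * g z"
    and w: "w \<in> Ks" and z: "z \<in> Ks" and wz: "norm (w - z) \<le> Dseq (gfun \<eta> L lam) \<eta> K n D t"
  shows "(avg ds ^^ k) f w powr (\<alpha> / (\<alpha> - 1)) \<le> C * (avg ds' ^^ k) g z"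
  using init w z wz
proof (induction k arbitrary: t w z)
  case 0
  then show ?case by simp
next
  case (Suc k)
  let ?D = "Dseq (gfun \<eta> L lam) \<eta> K n D"
  \<comment> \<open>The shift 0 makes the exponential factor in \<open>avg_powr_le\<close> equal to
    1.\<close>
  have "(avg ds ^^ k) f (proj (gd ds w + G)) powr (\<alpha> / (\<alpha> - 1)) \<le>
      C * (avg ds' ^^ k) g (proj (gd ds' z + (G + 0)))" for G
  proof (rule Suc.IH[of "Suc t"])
    \<comment> \<open>One bound on \<open>?r\<close> for each term of the minimum in
      \<open>Dseq\<close>.\<close>
    let ?r = "norm (proj (gd ds w + G) - proj (gd ds' z + (G + 0)))"
    have r: "?r \<le> norm (gd ds w - gd ds' z)"
      using norm_proj_diff_le[of "gd ds w + G" "gd ds' z + (G + 0)"] by simp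
    have "gfun \<eta> L lam (norm (w - z)) \<le> gfun \<eta> L lam (?D t)"
      using Suc.prems params L lam by (intro gfun_mono) auto
    then have "?r \<le> gfun \<eta> L lam (?D t) + 2 * \<eta> * K / real n"
      using r norm_gd_diff_le_holder[OF adj Suc.prems(2,3)] by simp
    moreover have "?r \<le> ?D t + 2 * \<eta> * K"
      using r norm_gd_diff_le[of ds w ds' z] Suc.prems by simp
    moreover have "?r \<le> D"
      using diameter_bounded_bound[OF bounded proj_in proj_in] D by (auto simp: dist_norm)
    ultimately show "?r \<le> ?D (Suc t)" by simp
  qed (use Suc.prems in \<open>auto simp: proj_in\<close>)
  from avg_powr_le[OF \<alpha> Suc.prems(2,3) C admissible_funpow_avg[OF f] admissible_funpow_avg[OF g] this]
  show ?case by simp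
qed

end

section \<open>The privacy bound\<close>

theorem mainTheorem2:
  fixes Ks :: "'a::euclidean_space set"
    and loss :: "'x \<Rightarrow> 'a \<Rightarrow> real" and grad :: "'x \<Rightarrow> 'a \<Rightarrow> 'a"
    and D K \<eta> \<sigma> L lam \<alpha> :: real and n T \<tau> :: nat
    and W0 :: 'a and ds ds' :: "nat \<Rightarrow> 'x"
    and \<beta> a :: "nat \<Rightarrow> real"
  assumes Ks: "Ks \<noteq> {}" "closed Ks" "convex Ks" "bounded Ks" "diameter Ks = D"
    and grad: "\<And>d w. w \<in> Ks \<Longrightarrow> (loss d has_derivative (\<lambda>v. grad d w \<bullet> v)) (at w)"
    and holder: "\<And>d w w'. w \<in> Ks \<Longrightarrow> w' \<in> Ks \<Longrightarrow>
                   norm (grad d w - grad d w') \<le> L * norm (w - w') powr lam"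
    and L: "L \<ge> 0" and lam: "0 < lam" "lam \<le> 1"
    and params: "K > 0" "\<eta> > 0" "\<sigma> > 0" "n \<ge> 1" "T \<ge> 1"
    and W0: "W0 \<in> Ks"
    and adj: "\<exists>i<n. ds i \<noteq> ds' i \<and> (\<forall>j<n. j \<noteq> i \<longrightarrow> ds j = ds' j)"
    and alpha: "\<alpha> > 1"
    and tau: "\<tau> < T"
    and beta: "\<And>t. \<tau> \<le> t \<Longrightarrow> t < T \<Longrightarrow> 0 \<le> \<beta> t \<and> \<beta> t \<le> 1"
    and a: "\<And>t. \<tau> \<le> t \<Longrightarrow> t < T \<Longrightarrow> 0 \<le> a t"
    and feasible: "Aseq (hfun \<eta> L lam) a T \<tau> \<ge> Dseq (gfun \<eta> L lam) \<eta> K n D \<tau>"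
  shows "renyi_div \<alpha> (noisy_sgd Ks grad K \<eta> \<sigma> n ds W0 T) (noisy_sgd Ks grad K \<eta> \<sigma> n ds' W0 T)
         \<le> ereal (\<alpha> / (2 * \<sigma>\<^sup>2)) *
            (\<Sum>t\<in>{\<tau>..<T}. ediv ((2 * \<eta> * K / real n)\<^sup>2) (\<beta> t) + ediv ((a t)\<^sup>2) (1 - \<beta> t))"
proof -
  interpret holder_noisy_sgd Ks grad K \<eta> \<sigma> L lam n
    using Ks holder L lam params by unfold_locales auto
  obtain i where i: "i < n" "\<forall>j<n. j \<noteq> i \<longrightarrow> ds j = ds' j" using adj by blast
  let ?s = "2 * \<eta> * K / real n"
  let ?P = "noisy_sgd Ks grad K \<eta> \<sigma> n ds W0 T" and ?Q = "noisy_sgd Ks grad K \<eta> \<sigma> n ds' W0 T"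
  define p where "p = \<alpha> / (\<alpha> - 1)"
  have p: "p > 1" using alpha by (simp add: p_def)
  \<comment> \<open>The cost before splitting: from time \<tau> on, each step absorbs a shift of
    norm at most \<open>?s + a t\<close>.\<close>
  define \<epsilon> where "\<epsilon> = \<alpha> / (2 * \<sigma>\<^sup>2) * (\<Sum>t\<in>{\<tau>..<T}. (?s + a t)\<^sup>2)"
  have sets: "sets ?P = sets borel" "sets ?Q = sets borel"
    using noisy_sgd_prob_space by blast+
  have "renyi_div \<alpha> ?P ?Q \<le> ereal \<epsilon>"
  proof (rule renyi_div_leI)
    show "0 \<le> \<epsilon>"
      unfolding \<epsilon>_def using alpha by (intro mult_nonneg_nonneg sum_nonneg) auto
    fix f :: "'a \<Rightarrow> real" and B
    assume "f \<in> borel_measurable ?Q" and fb: "\<And>x. 0 \<le> f x" "\<And>x. f x \<le> B"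
    then have f_meas [measurable]: "f \<in> borel_measurable borel"
      using measurable_cong_sets[OF sets(2) refl] by blast
    define g where "g = (\<lambda>x. f x powr p)"
    have f: "admissible B f" using fb by (simp add: admissible_def)
    have g: "admissible (B powr p) g"
      using fb p by (auto simp: admissible_def g_def intro!: powr_mono2)
    \<comment> \<open>From time \<tau> on: by feasibility, points within D_\<tau> are within
      A_\<tau>. The index \<open>0 + \<tau>\<close> fits \<open>t + k\<close> in the lemma for the
      earlier steps.\<close>
    have late: "(avg ds ^^ (T - \<tau>)) f w powr p \<le> exp \<epsilon> * (avg ds' ^^ (T - \<tau>)) g z"
      if "w \<in> Ks" "z \<in> Ks" "norm (w - z) \<le> Dseq (gfun \<eta> L lam) \<eta> K n D (0 + \<tau>)" for w z
    proof -
      have "(avg ds ^^ (T - \<tau>)) f w powr (\<alpha> / (\<alpha> - 1)) \<le>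
          exp (\<alpha> / (2 * \<sigma>\<^sup>2) * (\<Sum>t\<in>{T - (T - \<tau>)..<T}. (?s + a t)\<^sup>2)) * (avg ds' ^^ (T - \<tau>)) g z"
        using that feasible a tau
        by (intro funpow_avg_powr_le_Abk[OF alpha i _ _ f g]) (auto simp: g_def p_def Aseq_def)
      then show ?thesis using tau by (simp add: \<epsilon>_def p_def)
    qed
    \<comment> \<open>Up to time \<tau>: both chains start at \<open>W0\<close>, hence at distance 0
      = D_0.\<close>
    have "(avg ds ^^ \<tau>) ((avg ds ^^ (T - \<tau>)) f) W0 powr (\<alpha> / (\<alpha> - 1)) \<le>
        exp \<epsilon> * (avg ds' ^^ \<tau>) ((avg ds' ^^ (T - \<tau>)) g) W0"
      using late W0 unfolding p_def
      by (intro funpow_avg_powr_le_Dseq[OF alpha \<open>bounded Ks\<close> \<open>diameter Ks = D\<close> i admissible_funpow_avg[OF f]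
            admissible_funpow_avg[OF g], where t = 0]) auto
    moreover have "(avg d ^^ \<tau>) ((avg d ^^ (T - \<tau>)) h) = (avg d ^^ T) h" for d h
      using funpow_add[of \<tau> "T - \<tau>" "avg d"] tau by simp
    ultimately show "(\<integral>x. f x \<partial>?P) powr (\<alpha> / (\<alpha> - 1)) \<le> exp \<epsilon> * (\<integral>x. f x powr (\<alpha> / (\<alpha> - 1)) \<partial>?Q)"
      using integral_noisy_sgd[OF f, of ds W0 T] integral_noisy_sgd[OF g, of ds' W0 T]
      by (simp add: g_def p_def)
  qed (use noisy_sgd_prob_space sets alpha in auto)
  also have "ereal \<epsilon> = ereal (\<alpha> / (2 * \<sigma>\<^sup>2)) * (\<Sum>t\<in>{\<tau>..<T}. ereal ((?s + a t)\<^sup>2))"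
    by (simp add: \<epsilon>_def)
  \<comment> \<open>The weights \<beta> enter here, splitting each square into the part for the
    changed sample and the part for \<open>a t\<close>.\<close>
  also have "\<dots> \<le> ereal (\<alpha> / (2 * \<sigma>\<^sup>2)) *
      (\<Sum>t\<in>{\<tau>..<T}. ediv (?s\<^sup>2) (\<beta> t) + ediv ((a t)\<^sup>2) (1 - \<beta> t))"
    using alpha beta a params by (intro ereal_mult_left_mono sum_mono square_add_le_ediv) auto
  finally show ?thesis .
qed

end
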